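(* Let $n\ge 2$ be an integer and $q$ a prime power, with $n+q\to\infty$. Let $X$ be the random subset of $\mathbb{F}_q^n$ in which each element of $\mathbb{F}_q^n$ is included independently with probability $\theta$. Let $\ell$ be an integer with $3\le \ell\le q$ and $\ell=O(n\ln q)$. Then the event $\Gamma=\Gamma(\theta;\ell)$ that there is an $\ell$-rich line with respect to $X$ has threshold function $\left(q^{2n-2}\binom{q}{\ell}\right)^{-1/\ell}$.
   Context: A line in $\mathbb{F}_q^n$ is a 1-dimensional affine subspace (translate of a 1-dimensional linear subspace). A flat $L$ is $\ell$-rich with respect to $X$ if $|L\cap X|\ge \ell$. A function $t$ is a threshold function for $\Gamma$ if $\Pr[\Gamma]\to0$ whenever $\theta=o(t)$ and $\Pr[\Gamma]\to1$ whenever $\theta=\omega(t)$. *)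

theory Defs
  imports
    "HOL-Probability.Probability"
    "HOL-Library.Landau_Symbols"
    "HOL-Number_Theory.Prime_Powers"
    "HOL-Algebra.AbelCoset"
    "Jordan_Normal_Form.Missing_VectorSpace"
begin

text \<open>
  The ambient space is \<^term>\<open>ring.func_space F {..<n}\<close>: coordinate vectors are extensional
  functions on \<open>{..<n}\<close>. The field is a locale-based one, since both \<open>n\<close> and \<open>q\<close>
  vary along a sequence.
\<close>

abbreviation affine_space :: "('a, 'm) ring_scheme \<Rightarrow> nat \<Rightarrow> ('a, nat \<Rightarrow> 'a) module" where
  "affine_space F n \<equiv> ring.func_space F {..<n}"

definition is_flat :: "('a, 'm) ring_scheme \<Rightarrow> nat \<Rightarrow> nat \<Rightarrow> (nat \<Rightarrow> 'a) set \<Rightarrow> bool" where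
  "is_flat F n d L \<longleftrightarrow>
     (\<exists>W. VectorSpace.subspace F W (affine_space F n) \<and>
          vectorspace.dim F ((affine_space F n)\<lparr>carrier := W\<rparr>) = d \<and>
          (\<exists>a\<in>carrier (affine_space F n). L = a <+\<^bsub>affine_space F n\<^esub> W))"

definition is_line :: "('a, 'm) ring_scheme \<Rightarrow> nat \<Rightarrow> (nat \<Rightarrow> 'a) set \<Rightarrow> bool" where
  "is_line F n L \<longleftrightarrow> is_flat F n 1 L"

definition rich :: "nat \<Rightarrow> 'b set \<Rightarrow> 'b set \<Rightarrow> bool" where
  "rich l X L \<longleftrightarrow> card (L \<inter> X) \<ge> l"

text \<open>
  Each element of the finite set \<open>S\<close> is included independently with probability \<open>\<theta>\<close>
  (meaningful for \<open>0 \<le> \<theta> \<le> 1\<close>).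
\<close>

definition random_subset :: "'b set \<Rightarrow> real \<Rightarrow> 'b set pmf" where
  "random_subset S \<theta> =
     map_pmf (\<lambda>b. {x\<in>S. b x}) (Pi_pmf S False (\<lambda>_. bernoulli_pmf \<theta>))"

definition prob_rich_line :: "('a, 'm) ring_scheme \<Rightarrow> nat \<Rightarrow> nat \<Rightarrow> real \<Rightarrow> real" where
  "prob_rich_line F n l \<theta> =
     measure_pmf.prob (random_subset (carrier (affine_space F n)) \<theta>)
       {X. \<exists>L. is_line F n L \<and> rich l X L}"

text \<open>
  \<open>P k \<theta>\<close> is the probability of the event in the \<open>k\<close>-th model with inclusion probability
  \<open>\<theta>\<close>; all asymptotics are along \<open>k \<rightarrow> \<infinity>\<close>.
\<close>

definition threshold_function :: "(nat \<Rightarrow> real \<Rightarrow> real) \<Rightarrow> (nat \<Rightarrow> real) \<Rightarrow> bool" where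
  "threshold_function P t \<longleftrightarrow>
     (\<forall>\<theta>. (\<forall>k. 0 \<le> \<theta> k \<and> \<theta> k \<le> 1) \<longrightarrow>
        (\<theta> \<in> o(t) \<longrightarrow> (\<lambda>k. P k (\<theta> k)) \<longlonglongrightarrow> 0) \<and>
        (\<theta> \<in> \<omega>(t) \<longrightarrow> (\<lambda>k. P k (\<theta> k)) \<longlonglongrightarrow> 1))"

end

theory Submission
  imports Defs
begin

text \<open>
  The upper bound is the union bound over lines. For the lower bound, apply Chebyshev's inequality
  to the number \<open>Z\<close> of rich lines. Let \<open>b\<close> be the number of lines, \<open>p\<close> the probability that
  a given line is rich, and \<open>r\<close> the probability that a line with one point removed contains exactly
  \<open>l - 1\<close> random points. Disjoint lines are independent, and the indicators of two lines meeting
  in one point have covariance \<open>\<theta> (1 - \<theta>) r\<^sup>2\<close>, where \<open>q \<theta> r \<le> l p\<close>. Since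
  the affine lines form a linear space, this sums up to
  \<open>P(Z = 0) \<le> 1 / (b p) + l\<^sup>2 / (q\<^sup>n \<theta>)\<close>.
  With \<open>t\<close> the threshold, one has \<open>p \<ge> 1 / q\<close> if \<open>q \<theta> \<ge> l\<close>, and
  \<open>b p \<ge> (\<theta> / (e t))\<^sup>l\<close> otherwise, while \<open>l\<^sup>2 \<le> 4 e q\<^sup>n t\<close> always holds.
\<close>

section \<open>Expectations over a random subset of a finite set\<close>

definition mean :: "'b set \<Rightarrow> real \<Rightarrow> ('b set \<Rightarrow> real) \<Rightarrow> real" where
  "mean S \<theta> f = measure_pmf.expectation (random_subset S \<theta>) f"

lemma random_subset_insert:
  assumes "finite A" "x \<notin> A"
  shows "random_subset (insert x A) \<theta> =
    bernoulli_pmf \<theta> \<bind> (\<lambda>b. map_pmf (\<lambda>X. if b then insert x X else X) (random_subset A \<theta>))"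
  unfolding random_subset_def Pi_pmf_insert'[OF assms] map_bind_pmf map_pmf_comp
  unfolding map_pmf_def[of _ "Pi_pmf _ _ _"] bind_return_pmf
  using assms
  by (intro bind_pmf_cong refl) (auto intro!: bind_pmf_cong)

lemma set_random_subset: "set_pmf (random_subset S \<theta>) \<subseteq> Pow S"
  by (auto simp: random_subset_def)

lemma finite_set_random_subset: "finite S \<Longrightarrow> finite (set_pmf (random_subset S \<theta>))"
  by (meson finite_Pow_iff finite_subset set_random_subset)

lemma mean_eq_sum:
  assumes "finite S"
  shows "mean S \<theta> f = (\<Sum>X\<in>Pow S. pmf (random_subset S \<theta>) X * f X)"
proof -
  have "mean S \<theta> f = (\<Sum>X\<in>Pow S. f X * pmf (random_subset S \<theta>) X)"
    unfolding mean_def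
    by (rule integral_measure_pmf_real) (use assms set_random_subset[of S \<theta>] in auto)
  thus ?thesis by (simp add: mult.commute)
qed

text \<open>Conditioning on whether \<open>x\<close> is chosen. This recursion drives the inductions
  below that compute expectations exactly, so no sum over all subsets has to be manipulated.\<close>

lemma mean_insert:
  assumes "finite A" "x \<notin> A" "0 \<le> \<theta>" "\<theta> \<le> 1"
  shows "mean (insert x A) \<theta> f = \<theta> * mean A \<theta> (\<lambda>X. f (insert x X)) + (1 - \<theta>) * mean A \<theta> f"
  unfolding mean_def random_subset_insert[OF assms(1,2)]
  using assms finite_set_random_subset[OF assms(1), of \<theta>]
  by (subst pmf_expectation_bind[where A = UNIV])
     (auto simp: UNIV_bool algebra_simps)

lemma mean_empty [simp]: "mean {} \<theta> f = f {}"
  by (simp add: mean_def random_subset_def)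

lemma mean_const [simp]: "mean S \<theta> (\<lambda>_. c) = c"
  by (simp add: mean_def)

lemma mean_cong:
  assumes "finite S" "\<And>X. X \<subseteq> S \<Longrightarrow> f X = g X"
  shows "mean S \<theta> f = mean S \<theta> g"
  using assms by (simp add: mean_eq_sum)

lemma mean_mono:
  assumes "finite S" "\<And>X. X \<subseteq> S \<Longrightarrow> f X \<le> g X"
  shows "mean S \<theta> f \<le> mean S \<theta> g"
  using assms by (auto simp: mean_eq_sum intro!: sum_mono mult_left_mono)

lemma mean_add: "finite S \<Longrightarrow> mean S \<theta> (\<lambda>X. f X + g X) = mean S \<theta> f + mean S \<theta> g"
  by (simp add: mean_eq_sum algebra_simps sum.distrib)

lemma mean_diff: "finite S \<Longrightarrow> mean S \<theta> (\<lambda>X. f X - g X) = mean S \<theta> f - mean S \<theta> g"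
  by (simp add: mean_eq_sum algebra_simps sum_subtractf)

lemma mean_cmult: "finite S \<Longrightarrow> mean S \<theta> (\<lambda>X. c * f X) = c * mean S \<theta> f"
  by (simp add: mean_eq_sum sum_distrib_left algebra_simps)

lemma mean_sum: "finite S \<Longrightarrow> mean S \<theta> (\<lambda>X. \<Sum>i\<in>I. f i X) = (\<Sum>i\<in>I. mean S \<theta> (f i))"
  by (simp add: mean_eq_sum sum_distrib_left) (rule sum.swap)

lemma prob_eq_mean:
  "measure_pmf.prob (random_subset S \<theta>) {X. P X} = mean S \<theta> (\<lambda>X. of_bool (P X))"
proof -
  have "(\<lambda>X. of_bool (P X) :: real) = indicat_real {X. P X}"
    by (auto simp: indicator_def)
  thus ?thesis
    by (simp add: mean_def)
qed

text \<open>Independence of the traces on disjoint sets, by induction on \<open>A\<close>. The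
  function \<open>f\<close> stays arbitrary because choosing the new point \<open>x\<close> replaces
  it by \<open>\<lambda>X. f (insert x X)\<close>.\<close>

lemma mean_indep:
  assumes "finite A" "finite B" "A \<inter> B = {}" "0 \<le> \<theta>" "\<theta> \<le> 1"
  shows "mean (A \<union> B) \<theta> (\<lambda>X. f (X \<inter> A) * g (X \<inter> B)) = mean A \<theta> f * mean B \<theta> g"
  using assms(1,3)
proof (induction A arbitrary: f)
  case empty
  have "mean B \<theta> (\<lambda>X. f {} * g (X \<inter> B)) = mean B \<theta> (\<lambda>X. f {} * g X)"
    by (rule mean_cong) (auto simp: assms Int_absorb2)
  thus ?case by (simp add: mean_cmult assms)
next
  case (insert x A)
  have fin: "finite (A \<union> B)" using insert assms by auto
  \<comment> \<open>Since \<open>x\<close> lies outside \<open>B\<close>, choosing it affects only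
    the argument of \<open>f\<close>.\<close>
  have 1: "mean (A \<union> B) \<theta> (\<lambda>X. f (insert x X \<inter> insert x A) * g (insert x X \<inter> B))
      = mean (A \<union> B) \<theta> (\<lambda>X. f (insert x (X \<inter> A)) * g (X \<inter> B))"
    using insert.prems by (intro mean_cong fin) simp_all
  have 2: "mean (A \<union> B) \<theta> (\<lambda>X. f (X \<inter> insert x A) * g (X \<inter> B))
      = mean (A \<union> B) \<theta> (\<lambda>X. f (X \<inter> A) * g (X \<inter> B))"
  proof (intro mean_cong fin)
    fix X assume "X \<subseteq> A \<union> B"
    hence "X \<inter> insert x A = X \<inter> A" using insert.prems insert.hyps by auto
    thus "f (X \<inter> insert x A) * g (X \<inter> B) = f (X \<inter> A) * g (X \<inter> B)" by simp
  qed
  have "mean (insert x A \<union> B) \<theta> (\<lambda>X. f (X \<inter> insert x A) * g (X \<inter> B))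
      = \<theta> * mean (A \<union> B) \<theta> (\<lambda>X. f (insert x (X \<inter> A)) * g (X \<inter> B))
        + (1 - \<theta>) * mean (A \<union> B) \<theta> (\<lambda>X. f (X \<inter> A) * g (X \<inter> B))"
    unfolding 1[symmetric] 2[symmetric] Un_insert_left
    by (rule mean_insert) (use insert assms in auto)
  also have "\<dots> = mean (insert x A) \<theta> f * mean B \<theta> g"
  proof -
    have "A \<inter> B = {}" using insert.prems by auto
    from insert.IH[OF this, of f] insert.IH[OF this, of "\<lambda>X. f (insert x X)"] show ?thesis
      using insert.hyps assms by (simp add: mean_insert algebra_simps)
  qed
  finally show ?case .
qed

lemma mean_marginal:
  assumes "finite S" "A \<subseteq> S" "0 \<le> \<theta>" "\<theta> \<le> 1"
  shows "mean S \<theta> (\<lambda>X. f (X \<inter> A)) = mean A \<theta> f"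
  using mean_indep[of A "S - A" \<theta> f "\<lambda>_. 1"] assms
  by (simp add: Un_absorb1 finite_subset)

lemma card_insert_subset:
  "finite A \<Longrightarrow> x \<notin> A \<Longrightarrow> X \<subseteq> A \<Longrightarrow> card (insert x X) = Suc (card X)"
  by (meson card_insert_disjoint finite_subset subsetD)

lemma mean_card:
  assumes "finite A" "0 \<le> \<theta>" "\<theta> \<le> 1"
  shows "mean A \<theta> (\<lambda>X. real (card X)) = real (card A) * \<theta>"
  using assms(1)
proof (induction A)
  case (insert x A)
  have "mean A \<theta> (\<lambda>X. real (card (insert x X))) = mean A \<theta> (\<lambda>X. 1 + real (card X))"
    using insert by (intro mean_cong) (simp_all add: card_insert_subset)
  with insert show ?case
    by (simp add: mean_insert mean_add assms algebra_simps)
qed simp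

text \<open>The random variable counts the \<open>k\<close>-subsets of the random set. Conditioning
  on one point turns Pascal's rule for \<open>card X\<close> into Pascal's rule for
  \<open>card A\<close>.\<close>

lemma mean_binomial_moment:
  assumes "finite A" "0 \<le> \<theta>" "\<theta> \<le> 1"
  shows "mean A \<theta> (\<lambda>X. real (card X choose k)) = real (card A choose k) * \<theta> ^ k"
  using assms(1)
proof (induction A arbitrary: k)
  case empty
  show ?case by (cases k) auto
next
  case (insert x A)
  show ?case
  proof (cases k)
    case (Suc j)
    have "mean A \<theta> (\<lambda>X. real (card (insert x X) choose k))
        = mean A \<theta> (\<lambda>X. real (card X choose j) + real (card X choose k))"
      unfolding Suc using insert
      by (intro mean_cong) (simp_all add: card_insert_subset)
    with insert Suc show ?thesis
      by (simp add: mean_insert mean_add assms algebra_simps)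
  qed simp
qed

lemma mean_card_eq:
  assumes "finite A" "0 \<le> \<theta>" "\<theta> \<le> 1"
  shows "mean A \<theta> (\<lambda>X. of_bool (card X = k))
    = real (card A choose k) * \<theta> ^ k * (1 - \<theta>) ^ (card A - k)"
  using assms(1)
proof (induction A arbitrary: k)
  case empty
  show ?case by (cases k) auto
next
  case (insert x A)
  have *: "mean A \<theta> (\<lambda>X. of_bool (card (insert x X) = k)) = mean A \<theta> (\<lambda>X. of_bool (Suc (card X) = k))"
    using insert by (intro mean_cong) (simp_all add: card_insert_subset)
  show ?case
  proof (cases k)
    case 0
    with insert * show ?thesis by (simp add: mean_insert assms)
  next
    case (Suc j)
    \<comment> \<open>Truncated subtraction matters here: for \<open>j < card A\<close> the exponent
      really grows by one, and otherwise the binomial coefficient vanishes.\<close>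
    have "(1 - \<theta>) * (real (card A choose Suc j) * \<theta> ^ Suc j * (1 - \<theta>) ^ (card A - Suc j))
        = real (card A choose Suc j) * \<theta> ^ Suc j * (1 - \<theta>) ^ (card A - j)"
    proof (cases "j < card A")
      case True
      hence "card A - j = Suc (card A - Suc j)" by simp
      thus ?thesis by simp
    qed simp
    with insert * Suc show ?thesis
      by (simp add: mean_insert assms algebra_simps)
  qed
qed

text \<open>The cardinality is binomially distributed, so only the size of the underlying set
  enters. This lets all lines share one richness probability.\<close>

lemma mean_card_cong:
  assumes "finite A" "finite A'" "card A = card A'" "0 \<le> \<theta>" "\<theta> \<le> 1"
  shows "mean A \<theta> (\<lambda>X. g (card X)) = mean A' \<theta> (\<lambda>X. g (card X))"
proof -
  have "mean S \<theta> (\<lambda>X. g (card X))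
      = (\<Sum>k\<le>card S. g k * (real (card S choose k) * \<theta> ^ k * (1 - \<theta>) ^ (card S - k)))"
    if "finite S" for S :: "'c set"
  proof -
    have "mean S \<theta> (\<lambda>X. g (card X)) = mean S \<theta> (\<lambda>X. \<Sum>k\<le>card S. g k * of_bool (card X = k))"
      using that by (intro mean_cong) (auto simp: card_mono of_bool_def if_distrib cong: if_cong)
    also have "\<dots> = (\<Sum>k\<le>card S. g k * mean S \<theta> (\<lambda>X. of_bool (card X = k)))"
      using that by (simp only: mean_sum mean_cmult)
    finally show ?thesis
      using that by (simp only: mean_card_eq assms)
  qed
  from this[OF assms(1)] this[OF assms(2)] show ?thesis
    using assms(3) by simp
qed

text \<open>The indicator of \<open>l \<le> card X\<close> is at most the number of
  \<open>l\<close>-subsets of \<open>X\<close>.\<close>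

lemma mean_card_ge_upper:
  assumes "finite A" "0 \<le> \<theta>" "\<theta> \<le> 1"
  shows "mean A \<theta> (\<lambda>X. of_bool (l \<le> card X)) \<le> real (card A choose l) * \<theta> ^ l"
  unfolding mean_binomial_moment[OF assms, symmetric]
  by (intro mean_mono assms) (simp add: Suc_le_eq)

lemma mean_card_ge_lower:
  assumes "finite A" "0 \<le> \<theta>" "\<theta> \<le> 1"
  shows "real (card A choose l) * \<theta> ^ l * (1 - \<theta>) ^ (card A - l)
    \<le> mean A \<theta> (\<lambda>X. of_bool (l \<le> card X))"
  unfolding mean_card_eq[OF assms, symmetric]
  by (intro mean_mono assms) simp

text \<open>From \<open>card X \<le> l - 1 + card A \<cdot> of_bool (l \<le> card X)\<close>, by taking expectations.\<close>

lemma mean_card_ge_inverse: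
  assumes "finite A" "0 \<le> \<theta>" "\<theta> \<le> 1" "1 \<le> l" "real l \<le> real (card A) * \<theta>"
  shows "1 \<le> real (card A) * mean A \<theta> (\<lambda>X. of_bool (l \<le> card X))"
proof -
  have "real (card A) * \<theta> \<le> mean A \<theta> (\<lambda>X. (real l - 1) + real (card A) * of_bool (l \<le> card X))"
    unfolding mean_card[OF assms(1-3), symmetric]
  proof (intro mean_mono assms)
    fix X assume "X \<subseteq> A"
    hence "card X \<le> card A" using assms card_mono by blast
    thus "real (card X) \<le> (real l - 1) + real (card A) * of_bool (l \<le> card X)"
      using \<open>1 \<le> l\<close> by (auto simp: of_bool_def)
  qed
  also have "\<dots> = (real l - 1) + real (card A) * mean A \<theta> (\<lambda>X. of_bool (l \<le> card X))"
    by (simp add: mean_add mean_cmult assms)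
  finally show ?thesis using assms by linarith
qed

section \<open>Covariance of two lines meeting in one point\<close>

text \<open>Condition on the common point \<open>x\<close>; the remainders \<open>A\<close> and
  \<open>A'\<close> are then independent. If a line is rich with probability \<open>a\<close> when
  \<open>x\<close> is chosen and \<open>b\<close> when it is not, the covariance is \<open>\<theta>
  a\<^sup>2 + (1 - \<theta>) b\<^sup>2 - (\<theta> a + (1 - \<theta>) b)\<^sup>2 = \<theta> (1 -
  \<theta>) (a - b)\<^sup>2\<close>.\<close>

lemma rich_covariance:
  assumes fin: "finite L" "finite L'" and int: "L \<inter> L' = {x}" and card: "card L = q" "card L' = q"
    and th: "0 \<le> \<theta>" "\<theta> \<le> 1" and l: "1 \<le> l"
  defines "p \<equiv> mean L \<theta> (\<lambda>X. of_bool (l \<le> card X))"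
  shows "mean (L \<union> L') \<theta> (\<lambda>X. of_bool (l \<le> card (L \<inter> X)) * of_bool (l \<le> card (L' \<inter> X))) - p\<^sup>2
     = \<theta> * (1 - \<theta>) * (real ((q - 1) choose (l - 1)) * \<theta> ^ (l - 1) * (1 - \<theta>) ^ (q - l))\<^sup>2"
proof -
  define A A' where "A = L - {x}" and "A' = L' - {x}"
  have L: "L = insert x A" "L' = insert x A'" and x: "x \<notin> A" "x \<notin> A'" and disj: "A \<inter> A' = {}"
    using int by (auto simp: A_def A'_def)
  have finA: "finite A" "finite A'" and cardA: "card A = q - 1" "card A' = q - 1"
  proof -
    have "x \<in> L" "x \<in> L'" using int by auto
    thus "card A = q - 1" "card A' = q - 1" using fin card by (simp_all add: A_def A'_def)
  qed (use fin in \<open>auto simp: A_def A'_def\<close>)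
  define a b where "a = mean A \<theta> (\<lambda>X. of_bool (l \<le> Suc (card X)))"
    and "b = mean A \<theta> (\<lambda>X. of_bool (l \<le> card X))"
  have a': "mean A' \<theta> (\<lambda>X. of_bool (l \<le> Suc (card X))) = a"
    and b': "mean A' \<theta> (\<lambda>X. of_bool (l \<le> card X)) = b"
    unfolding a_def b_def
    using mean_card_cong[OF finA(2,1) _ th, of "\<lambda>k. of_bool (l \<le> Suc k)"]
      mean_card_cong[OF finA(2,1) _ th, of "\<lambda>k. of_bool (l \<le> k)"] cardA by simp_all
  have shift: "mean C \<theta> (\<lambda>X. of_bool (l \<le> card (insert x X)))
      = mean C \<theta> (\<lambda>X. of_bool (l \<le> Suc (card X)))"
    if "finite C" "x \<notin> C" for C
    using that by (intro mean_cong) (simp_all add: card_insert_subset)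
  have p: "p = \<theta> * a + (1 - \<theta>) * b"
    unfolding p_def L a_def b_def using finA x th by (simp add: mean_insert shift)
  \<comment> \<open>The point \<open>x\<close> is decisive exactly when the rest of the line
    contributes \<open>l - 1\<close> points.\<close>
  have "a - b = mean A \<theta> (\<lambda>X. of_bool (card X = l - 1))"
    unfolding a_def b_def mean_diff[OF finA(1), symmetric]
    using l by (intro mean_cong finA) (auto simp: of_bool_def)
  hence r: "a - b = real ((q - 1) choose (l - 1)) * \<theta> ^ (l - 1) * (1 - \<theta>) ^ (q - l)"
    using l by (simp add: mean_card_eq finA th cardA)
  have "mean (L \<union> L') \<theta> (\<lambda>X. of_bool (l \<le> card (L \<inter> X)) * of_bool (l \<le> card (L' \<inter> X)))
      = mean (insert x (A \<union> A')) \<theta> (\<lambda>X. of_bool (l \<le> card (L \<inter> X)) * of_bool (l \<le> card (L' \<inter> X)))"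
    by (simp add: L)
  also have "\<dots> = \<theta> * mean (A \<union> A') \<theta> (\<lambda>X. of_bool (l \<le> card (L \<inter> insert x X)) * of_bool (l \<le> card (L' \<inter> insert x X)))
      + (1 - \<theta>) * mean (A \<union> A') \<theta> (\<lambda>X. of_bool (l \<le> card (L \<inter> X)) * of_bool (l \<le> card (L' \<inter> X)))"
    by (rule mean_insert) (use finA x th in auto)
  also have "mean (A \<union> A') \<theta> (\<lambda>X. of_bool (l \<le> card (L \<inter> insert x X)) * of_bool (l \<le> card (L' \<inter> insert x X)))
      = mean (A \<union> A') \<theta> (\<lambda>X. of_bool (l \<le> card (insert x (X \<inter> A))) * of_bool (l \<le> card (insert x (X \<inter> A'))))"
    by (simp add: L Int_commute)
  also have "\<dots> = a * a"
    using mean_indep[OF finA disj th, of "\<lambda>X. of_bool (l \<le> card (insert x X))" "\<lambda>X. of_bool (l \<le> card (insert x X))"]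
      finA x a' by (simp add: shift a_def)
  also have "mean (A \<union> A') \<theta> (\<lambda>X. of_bool (l \<le> card (L \<inter> X)) * of_bool (l \<le> card (L' \<inter> X)))
      = mean (A \<union> A') \<theta> (\<lambda>X. of_bool (l \<le> card (X \<inter> A)) * of_bool (l \<le> card (X \<inter> A')))"
  proof (intro mean_cong)
    fix X assume "X \<subseteq> A \<union> A'"
    hence "L \<inter> X = X \<inter> A" "L' \<inter> X = X \<inter> A'" using x by (auto simp: L)
    thus "of_bool (l \<le> card (L \<inter> X)) * of_bool (l \<le> card (L' \<inter> X))
      = (of_bool (l \<le> card (X \<inter> A)) * of_bool (l \<le> card (X \<inter> A')) :: real)" by simp
  qed (use finA in auto)
  also have "\<dots> = b * b"
    using mean_indep[OF finA disj th, of "\<lambda>X. of_bool (l \<le> card X)" "\<lambda>X. of_bool (l \<le> card X)"] b'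
    by (simp add: b_def)
  finally show ?thesis
    unfolding r[symmetric] p by (simp add: power2_eq_square algebra_simps)
qed

text \<open>The absorption identity for binomial coefficients turns \<open>q * \<theta> * r\<close>
  into \<open>l\<close> times the probability of exactly \<open>l\<close> points, which is at most
  \<open>l * p\<close>. Squaring expresses the covariance in terms of \<open>p\<close>, which later
  cancels against the squared expectation.\<close>

lemma rich_covariance_le:
  assumes fin: "finite L" "finite L'" and int: "L \<inter> L' = {x}" and card: "card L = q" "card L' = q"
    and th: "0 < \<theta>" "\<theta> \<le> 1" and l: "1 \<le> l"
  defines "p \<equiv> mean L \<theta> (\<lambda>X. of_bool (l \<le> card X))"
  shows "mean (L \<union> L') \<theta> (\<lambda>X. of_bool (l \<le> card (L \<inter> X)) * of_bool (l \<le> card (L' \<inter> X))) - p\<^sup>2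
     \<le> (real l)\<^sup>2 * p\<^sup>2 / ((real q)\<^sup>2 * \<theta>)"
proof -
  define r where "r = real ((q - 1) choose (l - 1)) * \<theta> ^ (l - 1) * (1 - \<theta>) ^ (q - l)"
  have r0: "0 \<le> r" using th by (simp add: r_def)
  have q0: "0 < q" using fin int card card_gt_0_iff by fastforce
  have "real q * \<theta> * r = real l * (real (q choose l) * \<theta> ^ l * (1 - \<theta>) ^ (q - l))"
  proof -
    have "l * (q choose l) = q * ((q - 1) choose (l - 1))"
      using l times_binomial_minus1_eq[of l q] by simp
    hence "real l * real (q choose l) = real q * real ((q - 1) choose (l - 1))"
      by (metis of_nat_mult)
    moreover have "\<theta> ^ l = \<theta> * \<theta> ^ (l - 1)" using l by (cases l) auto
    ultimately show ?thesis by (simp add: r_def)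
  qed
  also have "\<dots> \<le> real l * p"
    using mean_card_ge_lower[OF fin(1), of \<theta> l] th card by (intro mult_left_mono) (auto simp: p_def)
  finally have "(real q * \<theta> * r)\<^sup>2 \<le> (real l * p)\<^sup>2"
    using th r0 by (intro power_mono) auto
  hence "\<theta> * r\<^sup>2 \<le> (real l)\<^sup>2 * p\<^sup>2 / ((real q)\<^sup>2 * \<theta>)"
    using th q0 by (simp add: field_simps power2_eq_square)
  moreover have "\<theta> * (1 - \<theta>) * r\<^sup>2 \<le> \<theta> * r\<^sup>2"
    using th by (intro mult_right_mono) (auto simp: mult_left_le)
  ultimately show ?thesis
    unfolding p_def rich_covariance[OF fin int card less_imp_le[OF th(1)] th(2) l] r_def
    by (rule order.trans[rotated])
qed

section \<open>Counting and second moments in a finite linear space\<close>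

text \<open>A 2-design of index 1. These axioms are all that the counting and variance arguments use
  of affine geometry, so field arithmetic stays out of them.\<close>

locale linear_space =
  fixes V :: "'b set" and \<L> :: "'b set set" and q :: nat
  assumes finite_points: "finite V"
    and line_subset: "L \<in> \<L> \<Longrightarrow> L \<subseteq> V"
    and card_line: "L \<in> \<L> \<Longrightarrow> card L = q"
    and q_ge_2: "2 \<le> q"
    and joining_line: "x \<in> V \<Longrightarrow> y \<in> V \<Longrightarrow> x \<noteq> y \<Longrightarrow> \<exists>L\<in>\<L>. x \<in> L \<and> y \<in> L"
    and lines_meet: "L \<in> \<L> \<Longrightarrow> L' \<in> \<L> \<Longrightarrow> x \<in> L \<inter> L' \<Longrightarrow> y \<in> L \<inter> L' \<Longrightarrow> x \<noteq> y \<Longrightarrow> L = L'"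
begin

lemma finite_line: "L \<in> \<L> \<Longrightarrow> finite L"
  using line_subset finite_points finite_subset by blast

lemma finite_lines: "finite \<L>"
  by (rule finite_subset[of _ "Pow V"]) (use line_subset finite_points in auto)

text \<open>The lines through \<open>x\<close>, with \<open>x\<close> removed, partition the other
  points: they cover by \<open>joining_line\<close> and are disjoint by
  \<open>lines_meet\<close>.\<close>

lemma card_lines_through:
  assumes x: "x \<in> V"
  shows "card {L\<in>\<L>. x \<in> L} * (q - 1) = card V - 1"
proof -
  let ?S = "{L\<in>\<L>. x \<in> L}"
  have "V - {x} = (\<Union>L\<in>?S. L - {x})"
    using line_subset joining_line[OF x] by blast
  hence "card (V - {x}) = (\<Sum>L\<in>?S. card (L - {x}))"
    using finite_lines finite_line lines_meet
    by (simp only:, subst card_UN_disjoint) (auto, blast+)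
  also have "\<dots> = (\<Sum>L\<in>?S. q - 1)"
    by (intro sum.cong) (auto simp: card_line)
  finally show ?thesis
    using x finite_points by simp
qed

text \<open>Incident pairs of a point and a line are counted from both sides.\<close>

lemma card_lines_mult: "card \<L> * (q * (q - 1)) = card V * (card V - 1)"
proof -
  have "card \<L> * q = (\<Sum>L\<in>\<L>. card {x\<in>V. x \<in> L})"
  proof -
    have "{x\<in>V. x \<in> L} = L" if "L \<in> \<L>" for L using line_subset[OF that] by auto
    thus ?thesis by (simp add: card_line)
  qed
  also have "\<dots> = (\<Sum>x\<in>V. card {L\<in>\<L>. x \<in> L})"
    by (rule sum_multicount_gen[symmetric]) (use finite_points finite_lines in auto)
  finally have "card \<L> * q * (q - 1) = (\<Sum>x\<in>V. card {L\<in>\<L>. x \<in> L} * (q - 1))"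
    by (simp add: sum_distrib_right)
  also have "\<dots> = (\<Sum>x\<in>V. card V - 1)"
    by (intro sum.cong refl card_lines_through)
  finally show ?thesis
    by (simp add: mult.assoc)
qed

text \<open>Swapping the sums counts, for each point, the ordered pairs of lines through it. Every
  point is on the same number \<open>D\<close> of lines, so the total is
  \<open>card V * D\<^sup>2\<close>, and \<open>D\<close> is eliminated by counting
  incidences.\<close>

lemma sum_card_Int_lines:
  "(\<Sum>L\<in>\<L>. \<Sum>L'\<in>\<L>. real (card (L \<inter> L'))) = (real (card \<L>) * real q)\<^sup>2 / real (card V)"
proof (cases "V = {}")
  case True
  \<comment> \<open>A line would need at least two points. Both sides are then 0, the quotient
    having numerator 0.\<close>
  hence "\<L> = {}" using line_subset card_line q_ge_2 by fastforce
  thus ?thesis by simp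
next
  case False
  define D where "D = real (card V - 1) / real (q - 1)"
  have D: "real (card {L\<in>\<L>. x \<in> L}) = D" if "x \<in> V" for x
    using card_lines_through[OF that, THEN arg_cong[where f = real]] q_ge_2
    by (simp add: D_def field_simps)
  have "(\<Sum>L\<in>\<L>. \<Sum>L'\<in>\<L>. real (card (L \<inter> L')))
      = (\<Sum>L\<in>\<L>. \<Sum>L'\<in>\<L>. \<Sum>x\<in>V. of_bool (x \<in> L) * of_bool (x \<in> L'))"
  proof (intro sum.cong refl)
    fix L L' assume "L \<in> \<L>"
    hence "L \<inter> L' = {x\<in>V. x \<in> L \<and> x \<in> L'}" using line_subset by auto
    thus "real (card (L \<inter> L')) = (\<Sum>x\<in>V. of_bool (x \<in> L) * of_bool (x \<in> L'))"
      using finite_points by (simp add: of_bool_conj[symmetric] Int_def)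
  qed
  also have "\<dots> = (\<Sum>L\<in>\<L>. \<Sum>x\<in>V. \<Sum>L'\<in>\<L>. of_bool (x \<in> L) * of_bool (x \<in> L'))"
    by (intro sum.cong refl sum.swap)
  also have "\<dots> = (\<Sum>x\<in>V. \<Sum>L\<in>\<L>. \<Sum>L'\<in>\<L>. of_bool (x \<in> L) * of_bool (x \<in> L'))"
    by (rule sum.swap)
  also have "\<dots> = (\<Sum>x\<in>V. D\<^sup>2)"
  proof (intro sum.cong refl)
    fix x assume "x \<in> V"
    hence "(\<Sum>L\<in>\<L>. of_bool (x \<in> L)) = D"
      using finite_lines D[of x] by (simp add: Int_def)
    thus "(\<Sum>L\<in>\<L>. \<Sum>L'\<in>\<L>. of_bool (x \<in> L) * of_bool (x \<in> L')) = D\<^sup>2"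
      by (simp add: sum_product[symmetric] power2_eq_square)
  qed
  also have "\<dots> = (real (card \<L>) * real q)\<^sup>2 / real (card V)"
  proof -
    have "real (card \<L>) * real q * real (q - 1) = real (card V) * real (card V - 1)"
      using card_lines_mult by (metis mult.assoc of_nat_mult)
    hence "real (card \<L>) * real q = real (card V) * D"
      using q_ge_2 by (simp add: D_def field_simps)
    thus ?thesis using False finite_points by (simp add: power2_eq_square)
  qed
  finally show ?thesis .
qed

lemma prob_rich_le:
  assumes th: "0 \<le> \<theta>" "\<theta> \<le> 1"
  shows "measure_pmf.prob (random_subset V \<theta>) {X. \<exists>L\<in>\<L>. rich l X L}
    \<le> real (card \<L>) * (real (q choose l) * \<theta> ^ l)"
proof -
  have "mean V \<theta> (\<lambda>X. of_bool (\<exists>L\<in>\<L>. rich l X L))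
      \<le> mean V \<theta> (\<lambda>X. \<Sum>L\<in>\<L>. of_bool (l \<le> card (X \<inter> L)))"
  proof (intro mean_mono finite_points)
    fix X
    show "of_bool (\<exists>L\<in>\<L>. rich l X L) \<le> (\<Sum>L\<in>\<L>. of_bool (l \<le> card (X \<inter> L)) :: real)"
    proof (cases "\<exists>L\<in>\<L>. rich l X L")
      case True
      then obtain L where "L \<in> \<L>" "l \<le> card (X \<inter> L)" by (auto simp: rich_def Int_commute)
      thus ?thesis
        using member_le_sum[of L \<L> "\<lambda>L. of_bool (l \<le> card (X \<inter> L)) :: real"] finite_lines True
        by simp
    qed (simp add: sum_nonneg)
  qed
  also have "\<dots> = (\<Sum>L\<in>\<L>. mean L \<theta> (\<lambda>X. of_bool (l \<le> card X)))"
    unfolding mean_sum[OF finite_points]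
  proof (intro sum.cong refl)
    fix L assume "L \<in> \<L>"
    thus "mean V \<theta> (\<lambda>X. of_bool (l \<le> card (X \<inter> L))) = mean L \<theta> (\<lambda>X. of_bool (l \<le> card X))"
      using mean_marginal[OF finite_points line_subset th, of L "\<lambda>X. of_bool (l \<le> card X)"] by simp
  qed
  also have "\<dots> \<le> (\<Sum>L\<in>\<L>. real (q choose l) * \<theta> ^ l)"
    by (intro sum_mono) (metis mean_card_ge_upper finite_line card_line th)
  finally show ?thesis
    by (simp add: prob_eq_mean)
qed

text \<open>One bound for three cases, shaped for summation over all pairs. Off the diagonal
  \<open>card (L \<inter> L')\<close> is 1 or 0, separating meeting lines from disjoint, hence
  independent, ones. On the diagonal the product of indicators has mean \<open>p\<close>, and the
  remaining terms only add slack.\<close>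

lemma covariance_lines_le:
  assumes th: "0 < \<theta>" "\<theta> \<le> 1" and l: "1 \<le> l" and LL: "L \<in> \<L>" "L' \<in> \<L>"
    and p: "\<And>L. L \<in> \<L> \<Longrightarrow> mean L \<theta> (\<lambda>X. of_bool (l \<le> card X)) = p"
  shows "mean V \<theta> (\<lambda>X. of_bool (l \<le> card (L \<inter> X)) * of_bool (l \<le> card (L' \<inter> X))) - p\<^sup>2
    \<le> of_bool (L = L') * p + (real l)\<^sup>2 * p\<^sup>2 / ((real q)\<^sup>2 * \<theta>) * real (card (L \<inter> L'))"
proof -
  note fin = finite_line[OF LL(1)] finite_line[OF LL(2)]
  have marg: "mean V \<theta> (\<lambda>X. of_bool (l \<le> card (L \<inter> X)) * of_bool (l \<le> card (L' \<inter> X)))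
     = mean (L \<union> L') \<theta> (\<lambda>X. of_bool (l \<le> card (L \<inter> X)) * of_bool (l \<le> card (L' \<inter> X)))"
  proof -
    have "L \<inter> (X \<inter> (L \<union> L')) = L \<inter> X" "L' \<inter> (X \<inter> (L \<union> L')) = L' \<inter> X" for X by auto
    thus ?thesis
      using mean_marginal[OF finite_points, of "L \<union> L'" \<theta>
          "\<lambda>X. of_bool (l \<le> card (L \<inter> X)) * of_bool (l \<le> card (L' \<inter> X))"]
        line_subset LL th by simp
  qed
  consider "L = L'" | x where "L \<inter> L' = {x}" "L \<noteq> L'" | "L \<inter> L' = {}" "L \<noteq> L'"
    using lines_meet[OF LL] by (cases "L = L'") blast+
  thus ?thesis
  proof cases
    case 1
    have "mean (L \<union> L') \<theta> (\<lambda>X. of_bool (l \<le> card (L \<inter> X)) * of_bool (l \<le> card (L' \<inter> X)))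
        = of_bool (L = L') * p"
      unfolding p[OF LL(1), symmetric] 1[symmetric]
      by (simp, intro mean_cong fin) (simp add: Int_absorb1)
    moreover have "0 \<le> (real l)\<^sup>2 * p\<^sup>2 / ((real q)\<^sup>2 * \<theta>) * real (card (L \<inter> L'))"
      using th by simp
    ultimately show ?thesis
      unfolding marg using zero_le_power2[of p] by linarith
  next
    case 2
    show ?thesis
      unfolding marg
      using rich_covariance_le[OF fin 2(1) card_line[OF LL(1)] card_line[OF LL(2)] th l] p[OF LL(1)] 2
      by simp
  next
    case 3
    have "mean (L \<union> L') \<theta> (\<lambda>X. of_bool (l \<le> card (L \<inter> X)) * of_bool (l \<le> card (L' \<inter> X))) = p * p"
      using mean_indep[OF fin 3(1), of \<theta> "\<lambda>X. of_bool (l \<le> card X)" "\<lambda>X. of_bool (l \<le> card X)"] th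
      by (simp add: p LL Int_commute)
    thus ?thesis unfolding marg using 3 by (simp add: power2_eq_square)
  qed
qed

text \<open>Chebyshev's inequality: when no line is rich, the number of rich lines deviates from its
  mean \<open>\<mu>\<close> by exactly \<open>\<mu>\<close>. The diagonal of the variance
  contributes \<open>\<mu>\<close>, the meeting pairs a multiple of
  \<open>\<mu>\<^sup>2\<close>.\<close>

lemma prob_no_rich_le:
  assumes th: "0 < \<theta>" "\<theta> \<le> 1" and l: "1 \<le> l"
    and p: "\<And>L. L \<in> \<L> \<Longrightarrow> mean L \<theta> (\<lambda>X. of_bool (l \<le> card X)) = p" and p0: "0 < p"
    and ne: "\<L> \<noteq> {}"
  shows "1 - measure_pmf.prob (random_subset V \<theta>) {X. \<exists>L\<in>\<L>. rich l X L}
    \<le> 1 / (real (card \<L>) * p) + (real l)\<^sup>2 / (real (card V) * \<theta>)"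
proof -
  define \<mu> where "\<mu> = real (card \<L>) * p"
  have \<mu>0: "0 < \<mu>" using ne p0 finite_lines by (simp add: \<mu>_def card_gt_0_iff)
  define Z where "Z L X = (of_bool (l \<le> card (L \<inter> X)) :: real)" for L X :: "'b set"
  define c where "c = (real l)\<^sup>2 * p\<^sup>2 / ((real q)\<^sup>2 * \<theta>)"
  note fp = finite_points
  have EZ: "mean V \<theta> (Z L) = p" if "L \<in> \<L>" for L
  proof -
    have "Z L = (\<lambda>X. of_bool (l \<le> card (X \<inter> L)))"
      by (simp add: fun_eq_iff Z_def Int_commute)
    thus ?thesis
      using mean_marginal[OF fp line_subset[OF that], of \<theta> "\<lambda>X. of_bool (l \<le> card X)"] th
      by (simp add: p[OF that])
  qed
  have "mean V \<theta> (\<lambda>X. \<mu>\<^sup>2 * of_bool (\<not> (\<exists>L\<in>\<L>. rich l X L)))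
      \<le> mean V \<theta> (\<lambda>X. ((\<Sum>L\<in>\<L>. Z L X - p))\<^sup>2)"
  proof (intro mean_mono fp)
    fix X
    show "\<mu>\<^sup>2 * of_bool (\<not> (\<exists>L\<in>\<L>. rich l X L)) \<le> ((\<Sum>L\<in>\<L>. Z L X - p))\<^sup>2"
    proof (cases "\<exists>L\<in>\<L>. rich l X L")
      case False
      hence "(\<Sum>L\<in>\<L>. Z L X - p) = - \<mu>" by (simp add: Z_def rich_def \<mu>_def)
      thus ?thesis by simp
    qed simp
  qed
  \<comment> \<open>The product of two centred indicators is written so that the last two terms have
    mean zero and only the covariance survives.\<close>
  also have "mean V \<theta> (\<lambda>X. ((\<Sum>L\<in>\<L>. Z L X - p))\<^sup>2)
      = mean V \<theta> (\<lambda>X. \<Sum>L\<in>\<L>. \<Sum>L'\<in>\<L>. (Z L X * Z L' X - p\<^sup>2) - p * (Z L X - p) - p * (Z L' X - p))"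
    by (simp add: power2_eq_square sum_product algebra_simps)
  also have "\<dots> = (\<Sum>L\<in>\<L>. \<Sum>L'\<in>\<L>. mean V \<theta> (\<lambda>X. Z L X * Z L' X) - p\<^sup>2)"
    by (simp add: mean_sum mean_diff mean_cmult fp EZ)
  also have "\<dots> \<le> (\<Sum>L\<in>\<L>. \<Sum>L'\<in>\<L>. of_bool (L = L') * p + c * real (card (L \<inter> L')))"
    unfolding Z_def c_def by (intro sum_mono covariance_lines_le th l p)
  also have "\<dots> = \<mu> + c * (\<Sum>L\<in>\<L>. \<Sum>L'\<in>\<L>. real (card (L \<inter> L')))"
  proof -
    have "(\<Sum>L'\<in>\<L>. of_bool (L = L') * p) = p" if "L \<in> \<L>" for L
    proof -
      have "\<L> \<inter> {L'. L = L'} = {L}" using that by auto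
      thus ?thesis using finite_lines by (simp add: sum_distrib_right[symmetric])
    qed
    thus ?thesis by (simp add: sum.distrib sum_distrib_left \<mu>_def)
  qed
  also have "\<dots> = \<mu> + \<mu>\<^sup>2 * ((real l)\<^sup>2 / (real (card V) * \<theta>))"
    using q_ge_2 unfolding sum_card_Int_lines by (simp add: c_def \<mu>_def power_mult_distrib mult_ac)
  finally have "\<mu>\<^sup>2 * mean V \<theta> (\<lambda>X. of_bool (\<not> (\<exists>L\<in>\<L>. rich l X L)))
      \<le> \<mu>\<^sup>2 * (1 / \<mu> + (real l)\<^sup>2 / (real (card V) * \<theta>))"
    using \<mu>0 by (simp add: mean_cmult fp algebra_simps power2_eq_square)
  hence "mean V \<theta> (\<lambda>X. of_bool (\<not> (\<exists>L\<in>\<L>. rich l X L))) \<le> 1 / \<mu> + (real l)\<^sup>2 / (real (card V) * \<theta>)"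
    using \<mu>0 by simp
  moreover have "mean V \<theta> (\<lambda>X. of_bool (\<not> (\<exists>L\<in>\<L>. rich l X L)))
      = 1 - mean V \<theta> (\<lambda>X. of_bool (\<exists>L\<in>\<L>. rich l X L))"
    using mean_diff[OF fp, of \<theta> "\<lambda>_. 1" "\<lambda>X. of_bool (\<exists>L\<in>\<L>. rich l X L)"]
    by (simp only: of_bool_not_iff mean_const)
  ultimately show ?thesis by (simp add: prob_eq_mean \<mu>_def)
qed

end

section \<open>Affine lines in parametric form\<close>

definition param_line :: "('a, 'm) ring_scheme \<Rightarrow> ('a, 'b, 'n) module_scheme \<Rightarrow> 'b \<Rightarrow> 'b \<Rightarrow> 'b set" where
  "param_line K V a w = (\<lambda>c. a \<oplus>\<^bsub>V\<^esub> c \<odot>\<^bsub>V\<^esub> w) ` carrier K"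

context vectorspace
begin

lemma span_singleton:
  assumes "w \<in> carrier V"
  shows "span {w} = (\<lambda>c. c \<odot>\<^bsub>V\<^esub> w) ` carrier K"
proof -
  have "lincomb a {w} = a w \<odot>\<^bsub>V\<^esub> w" if "a \<in> {w} \<rightarrow> carrier K" for a
    using assms that by (simp add: lincomb_def)
  moreover have "span {w} = {lincomb a {w} |a. a \<in> {w} \<rightarrow> carrier K}"
    using finite_span[of "{w}"] assms by auto
  \<comment> \<open>A scalar is turned into a coefficient function on \<open>{w}\<close> by taking
    it constant.\<close>
  ultimately show ?thesis
    by (auto simp: image_iff intro!: exI[of _ "\<lambda>_. _"])
qed

lemma subspace_dim_1_iff:
  assumes fin: "finite (carrier V)"
  shows "VectorSpace.subspace K W V \<and> vectorspace.dim K (V\<lparr>carrier := W\<rparr>) = 1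
    \<longleftrightarrow> (\<exists>w\<in>carrier V. w \<noteq> \<zero>\<^bsub>V\<^esub> \<and> W = (\<lambda>c. c \<odot>\<^bsub>V\<^esub> w) ` carrier K)"
proof
  assume W: "VectorSpace.subspace K W V \<and> vectorspace.dim K (V\<lparr>carrier := W\<rparr>) = 1"
  interpret W: vectorspace K "V\<lparr>carrier := W\<rparr>"
    using W by (intro subspace_is_vs) auto
  have sub: "submodule K W V" using W by (simp add: subspace_def)
  hence WV: "W \<subseteq> carrier V" by (simp add: submodule_def)
  \<comment> \<open>The dimension is a least cardinality of finite generating sets. It is attained
    once one such set is known, and \<open>W\<close> itself serves because \<open>V\<close> is
    finite.\<close>
  have "\<exists>A. finite A \<and> card A = W.dim \<and> A \<subseteq> carrier (V\<lparr>carrier := W\<rparr>) \<and> W.gen_set A"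
    unfolding W.dim_def
  proof (rule LeastI_ex)
    have "W.gen_set W"
      using W.in_own_span[of W] W.span_is_subset2[of W] by auto
    thus "\<exists>n A. finite A \<and> card A = n \<and> A \<subseteq> carrier (V\<lparr>carrier := W\<rparr>) \<and> W.gen_set A"
      using finite_subset[OF WV fin] by auto
  qed
  then obtain w where w: "w \<in> W" "W.gen_set {w}"
    using W by (auto simp: card_1_singleton_iff)
  \<comment> \<open>A generating set consisting of zero alone would make the dimension 0.\<close>
  have "w \<noteq> \<zero>\<^bsub>V\<^esub>" using W.dim0I w(2) W by auto
  thus "\<exists>w\<in>carrier V. w \<noteq> \<zero>\<^bsub>V\<^esub> \<and> W = (\<lambda>c. c \<odot>\<^bsub>V\<^esub> w) ` carrier K"
    using w WV W.span_singleton[of w] by auto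
next
  assume "\<exists>w\<in>carrier V. w \<noteq> \<zero>\<^bsub>V\<^esub> \<and> W = (\<lambda>c. c \<odot>\<^bsub>V\<^esub> w) ` carrier K"
  then obtain w where w: "w \<in> carrier V" "w \<noteq> \<zero>\<^bsub>V\<^esub>" "W = span {w}"
    by (auto simp: span_singleton)
  have sub: "VectorSpace.subspace K W V"
    using w span_is_subspace[of "{w}"] by simp
  interpret W: vectorspace K "V\<lparr>carrier := W\<rparr>"
    using sub by (rule subspace_is_vs)
  have wW: "w \<in> W" using span_self w by simp
  have "W.gen_set {w}"
    using W.span_singleton[of w] wW w by (simp add: span_singleton)
  hence "W.dim = 1" using W.dim1I[of w] wW w by simp
  with sub show "VectorSpace.subspace K W V \<and> W.dim = 1" by simp
qed

lemma param_line_closed: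
  "a \<in> carrier V \<Longrightarrow> w \<in> carrier V \<Longrightarrow> param_line K V a w \<subseteq> carrier V"
  by (auto simp: param_line_def)

lemma base_in_param_line:
  "a \<in> carrier V \<Longrightarrow> w \<in> carrier V \<Longrightarrow> a \<in> param_line K V a w"
  unfolding param_line_def by (rule image_eqI[of _ _ "\<zero>\<^bsub>K\<^esub>"]) (simp_all add: smult_l_null)

text \<open>Replacing the base point by another point of the line amounts to the substitution
  \<open>c = s + (c - s)\<close> in the parameter.\<close>

lemma param_line_shift:
  assumes "a \<in> carrier V" "w \<in> carrier V" "s \<in> carrier K"
  shows "param_line K V (a \<oplus>\<^bsub>V\<^esub> s \<odot>\<^bsub>V\<^esub> w) w = param_line K V a w"
proof (intro equalityI subsetI)
  fix x assume "x \<in> param_line K V (a \<oplus>\<^bsub>V\<^esub> s \<odot>\<^bsub>V\<^esub> w) w"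
  then obtain c where c: "c \<in> carrier K" "x = (a \<oplus>\<^bsub>V\<^esub> s \<odot>\<^bsub>V\<^esub> w) \<oplus>\<^bsub>V\<^esub> c \<odot>\<^bsub>V\<^esub> w"
    by (auto simp: param_line_def)
  hence "x = a \<oplus>\<^bsub>V\<^esub> (s \<oplus>\<^bsub>K\<^esub> c) \<odot>\<^bsub>V\<^esub> w"
    using assms by (simp add: smult_l_distr M.a_assoc)
  thus "x \<in> param_line K V a w" using assms c by (auto simp: param_line_def)
next
  fix x assume "x \<in> param_line K V a w"
  then obtain c where c: "c \<in> carrier K" "x = a \<oplus>\<^bsub>V\<^esub> c \<odot>\<^bsub>V\<^esub> w"
    by (auto simp: param_line_def)
  have "c = s \<oplus>\<^bsub>K\<^esub> (c \<ominus>\<^bsub>K\<^esub> s)"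
    using assms c by (simp add: R.minus_eq R.a_comm R.r_neg2 R.a_lcomm R.r_neg)
  hence "c \<odot>\<^bsub>V\<^esub> w = s \<odot>\<^bsub>V\<^esub> w \<oplus>\<^bsub>V\<^esub> (c \<ominus>\<^bsub>K\<^esub> s) \<odot>\<^bsub>V\<^esub> w"
    using assms c by (metis R.minus_closed smult_l_distr)
  hence "x = (a \<oplus>\<^bsub>V\<^esub> s \<odot>\<^bsub>V\<^esub> w) \<oplus>\<^bsub>V\<^esub> (c \<ominus>\<^bsub>K\<^esub> s) \<odot>\<^bsub>V\<^esub> w"
    using assms c by (simp add: M.a_assoc)
  thus "x \<in> param_line K V (a \<oplus>\<^bsub>V\<^esub> s \<odot>\<^bsub>V\<^esub> w) w"
    using assms c unfolding param_line_def by blast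
qed

lemma param_line_scale:
  assumes "a \<in> carrier V" "w \<in> carrier V" "d \<in> carrier K" "d \<noteq> \<zero>\<^bsub>K\<^esub>"
  shows "param_line K V a (d \<odot>\<^bsub>V\<^esub> w) = param_line K V a w"
proof (intro equalityI subsetI)
  fix x assume "x \<in> param_line K V a (d \<odot>\<^bsub>V\<^esub> w)"
  then obtain c where c: "c \<in> carrier K" "x = a \<oplus>\<^bsub>V\<^esub> c \<odot>\<^bsub>V\<^esub> (d \<odot>\<^bsub>V\<^esub> w)"
    by (auto simp: param_line_def)
  hence "x = a \<oplus>\<^bsub>V\<^esub> (c \<otimes>\<^bsub>K\<^esub> d) \<odot>\<^bsub>V\<^esub> w"
    using assms by (simp add: smult_assoc1)
  thus "x \<in> param_line K V a w" using assms c by (auto simp: param_line_def)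
next
  fix x assume "x \<in> param_line K V a w"
  then obtain c where c: "c \<in> carrier K" "x = a \<oplus>\<^bsub>V\<^esub> c \<odot>\<^bsub>V\<^esub> w"
    by (auto simp: param_line_def)
  have d: "d \<in> Units K" using assms field_Units by blast
  have "c = (c \<otimes>\<^bsub>K\<^esub> inv\<^bsub>K\<^esub> d) \<otimes>\<^bsub>K\<^esub> d"
    using assms c d by (simp add: R.m_assoc)
  hence "x = a \<oplus>\<^bsub>V\<^esub> (c \<otimes>\<^bsub>K\<^esub> inv\<^bsub>K\<^esub> d) \<odot>\<^bsub>V\<^esub> (d \<odot>\<^bsub>V\<^esub> w)"
    using assms c d by (metis R.Units_inv_closed R.m_closed smult_assoc1)
  thus "x \<in> param_line K V a (d \<odot>\<^bsub>V\<^esub> w)"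
    using assms c d unfolding param_line_def by blast
qed

text \<open>Move the base point to \<open>x\<close>, then rescale the direction to
  \<open>y - x\<close>. The resulting form depends on \<open>x\<close> and \<open>y\<close> only,
  which yields uniqueness of the line through two points.\<close>

lemma param_line_through:
  assumes "a \<in> carrier V" "w \<in> carrier V"
    and "x \<in> param_line K V a w" "y \<in> param_line K V a w" "x \<noteq> y"
  shows "param_line K V a w = param_line K V x (y \<ominus>\<^bsub>V\<^esub> x)"
proof -
  obtain s where s: "s \<in> carrier K" "x = a \<oplus>\<^bsub>V\<^esub> s \<odot>\<^bsub>V\<^esub> w"
    using assms by (auto simp: param_line_def)
  have x: "x \<in> carrier V" using assms s by simp
  have eq: "param_line K V x w = param_line K V a w"
    using assms s by (simp add: param_line_shift)
  obtain d where d: "d \<in> carrier K" "y = x \<oplus>\<^bsub>V\<^esub> d \<odot>\<^bsub>V\<^esub> w"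
    using assms(4) unfolding eq[symmetric] by (auto simp: param_line_def)
  have "d \<noteq> \<zero>\<^bsub>K\<^esub>" using assms d x by (auto simp: smult_l_null)
  moreover have "y \<ominus>\<^bsub>V\<^esub> x = d \<odot>\<^bsub>V\<^esub> w"
    using d x assms by (simp add: M.minus_eq M.a_comm M.r_neg2 M.a_lcomm)
  ultimately show ?thesis
    using param_line_scale[OF x assms(2) d(1)] eq by simp
qed

text \<open>The parametrization is injective: if \<open>c\<close> and \<open>d\<close> gave the same
  point, the unit \<open>c - d\<close> would annihilate \<open>w\<close>.\<close>

lemma card_param_line:
  assumes "a \<in> carrier V" "w \<in> carrier V" "w \<noteq> \<zero>\<^bsub>V\<^esub>"
  shows "card (param_line K V a w) = card (carrier K)"
  unfolding param_line_def
proof (rule card_image, rule inj_onI)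
  fix c d assume cd: "c \<in> carrier K" "d \<in> carrier K" and eq: "a \<oplus>\<^bsub>V\<^esub> c \<odot>\<^bsub>V\<^esub> w = a \<oplus>\<^bsub>V\<^esub> d \<odot>\<^bsub>V\<^esub> w"
  hence e: "c \<odot>\<^bsub>V\<^esub> w = d \<odot>\<^bsub>V\<^esub> w" using assms by simp
  show "c = d"
  proof (rule ccontr)
    assume "c \<noteq> d"
    hence "c \<ominus>\<^bsub>K\<^esub> d \<noteq> \<zero>\<^bsub>K\<^esub>" using cd by simp
    hence u: "c \<ominus>\<^bsub>K\<^esub> d \<in> Units K" using cd field_Units by simp
    have "(c \<ominus>\<^bsub>K\<^esub> d) \<odot>\<^bsub>V\<^esub> w = \<zero>\<^bsub>V\<^esub>"
      using cd assms e by (simp add: R.minus_eq smult_l_distr smult_l_minus M.r_neg)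
    hence "inv\<^bsub>K\<^esub> (c \<ominus>\<^bsub>K\<^esub> d) \<odot>\<^bsub>V\<^esub> ((c \<ominus>\<^bsub>K\<^esub> d) \<odot>\<^bsub>V\<^esub> w) = \<zero>\<^bsub>V\<^esub>"
      using u by (simp add: smult_r_null)
    hence "w = \<zero>\<^bsub>V\<^esub>"
      using u cd assms by (simp add: smult_assoc1[symmetric])
    with assms show False by simp
  qed
qed

lemma linear_space_param_lines:
  assumes "finite (carrier K)" "finite (carrier V)"
  shows "linear_space (carrier V)
    {param_line K V a w | a w. a \<in> carrier V \<and> w \<in> carrier V \<and> w \<noteq> \<zero>\<^bsub>V\<^esub>} (card (carrier K))"
proof (standard, goal_cases)
  \<comment> \<open>The line size is at least 2 because a field has distinct zero and one.\<close>
  case 4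
  have "card {\<zero>\<^bsub>K\<^esub>, \<one>\<^bsub>K\<^esub>} \<le> card (carrier K)" by (intro card_mono assms) auto
  thus ?case by simp
next
  case (5 x y)
  hence ne: "y \<ominus>\<^bsub>V\<^esub> x \<noteq> \<zero>\<^bsub>V\<^esub>" by simp
  have "y = x \<oplus>\<^bsub>V\<^esub> \<one>\<^bsub>K\<^esub> \<odot>\<^bsub>V\<^esub> (y \<ominus>\<^bsub>V\<^esub> x)"
    using 5 by (simp add: M.minus_eq M.a_lcomm[of x y] M.r_neg)
  hence "y \<in> param_line K V x (y \<ominus>\<^bsub>V\<^esub> x)" by (auto simp: param_line_def)
  moreover have "x \<in> param_line K V x (y \<ominus>\<^bsub>V\<^esub> x)" using 5 by (simp add: base_in_param_line)
  ultimately show ?case using 5 ne by blast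
next
  case (6 L L' x y)
  hence "L = param_line K V x (y \<ominus>\<^bsub>V\<^esub> x)" "L' = param_line K V x (y \<ominus>\<^bsub>V\<^esub> x)"
    using param_line_through[of _ _ x y] by auto
  thus ?case by simp
qed (use assms in \<open>auto simp: card_param_line dest!: subsetD[OF param_line_closed, rotated -1]\<close>)

end

section \<open>Lines of the coordinate space as a linear space\<close>

context field
begin

lemma vectorspace_affine_space: "vectorspace R (affine_space R n)"
  by (simp add: vectorspace_def field_axioms func_space_is_module)

lemma carrier_affine_space: "carrier (affine_space R n) = {..<n} \<rightarrow>\<^sub>E carrier R"
  by (simp add: func_space_def)

lemma card_affine_space: "card (carrier (affine_space R n)) = card (carrier R) ^ n"
  by (simp add: carrier_affine_space card_PiE)

lemma lines_eq_param_lines: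
  assumes "finite (carrier R)"
  shows "Collect (is_line R n) = {param_line R (affine_space R n) a w | a w.
    a \<in> carrier (affine_space R n) \<and> w \<in> carrier (affine_space R n) \<and> w \<noteq> \<zero>\<^bsub>affine_space R n\<^esub>}"
proof -
  interpret V: vectorspace R "affine_space R n" by (rule vectorspace_affine_space)
  have fin: "finite (carrier (affine_space R n))"
    using assms by (simp add: carrier_affine_space finite_PiE)
  have coset: "a <+\<^bsub>V\<^esub> ((\<lambda>c. c \<odot>\<^bsub>V\<^esub> w) ` carrier R) = param_line R V a w"
    for V :: "('a, nat \<Rightarrow> 'a) module" and a w
    by (auto simp: a_l_coset_def l_coset_def param_line_def)
  have "is_line R n L \<longleftrightarrow> (\<exists>W. (\<exists>w\<in>carrier (affine_space R n). w \<noteq> \<zero>\<^bsub>affine_space R n\<^esub> \<and>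
       W = (\<lambda>c. c \<odot>\<^bsub>affine_space R n\<^esub> w) ` carrier R) \<and>
       (\<exists>a\<in>carrier (affine_space R n). L = a <+\<^bsub>affine_space R n\<^esub> W))" for L
    unfolding is_line_def is_flat_def V.subspace_dim_1_iff[OF fin, symmetric] by blast
  thus ?thesis unfolding coset[symmetric] by blast
qed

lemma linear_space_lines:
  assumes "finite (carrier R)"
  shows "linear_space (carrier (affine_space R n)) (Collect (is_line R n)) (card (carrier R))"
  unfolding lines_eq_param_lines[OF assms]
  by (rule vectorspace.linear_space_param_lines[OF vectorspace_affine_space assms])
     (simp add: carrier_affine_space finite_PiE assms)

end

section \<open>Numerical estimates and the threshold\<close>

text \<open>For \<open>l < q\<close> one has \<open>\<theta> < 1\<close>, and
  \<open>1 - \<theta>\<close> is at least the exponential of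
  \<open>- \<theta> / (1 - \<theta>)\<close>. For \<open>q = l\<close> the power is 1, even if
  \<open>\<theta> = 1\<close>.\<close>

lemma exp_le_one_minus_power:
  fixes \<theta> :: real
  assumes "0 \<le> \<theta>" "real q * \<theta> \<le> real l" "l \<le> q" "0 < q"
  shows "exp (- real l) \<le> (1 - \<theta>) ^ (q - l)"
proof (cases "q = l")
  case False
  have "\<theta> \<le> real l / real q" using assms by (simp add: field_simps)
  also have "\<dots> < 1" using assms False by simp
  finally have th: "\<theta> < 1" .
  have "1 / (1 - \<theta>) = 1 + \<theta> / (1 - \<theta>)" using th by (simp add: field_simps)
  also have "\<dots> \<le> exp (\<theta> / (1 - \<theta>))" by (rule exp_ge_add_one_self)
  finally have "exp (- (\<theta> / (1 - \<theta>))) \<le> 1 - \<theta>"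
    using th by (simp add: exp_minus field_simps)
  hence "exp (- (\<theta> / (1 - \<theta>))) ^ (q - l) \<le> (1 - \<theta>) ^ (q - l)"
    by (intro power_mono) auto
  moreover have "exp (- (\<theta> / (1 - \<theta>))) ^ (q - l) = exp (- (real (q - l) * \<theta> / (1 - \<theta>)))"
    by (simp add: exp_of_nat_mult[symmetric])
  \<comment> \<open>After clearing the denominator this is the hypothesis
    \<open>real q * \<theta> \<le> real l\<close>.\<close>
  moreover have "real (q - l) * \<theta> / (1 - \<theta>) \<le> real l"
    using th assms by (simp add: field_simps of_nat_diff)
  ultimately show ?thesis by (smt (verit) exp_le_cancel_iff)
qed simp

text \<open>The term of index \<open>l\<close> of the binomial distribution with mean \<open>l\<close> is at most 1.\<close>

lemma choose_le_exp:
  assumes "l \<le> q" "0 < q"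
  shows "real (q choose l) * (real l / real q) ^ l \<le> exp (real l)"
proof -
  define \<theta> where "\<theta> = real l / real q"
  have th: "0 \<le> \<theta>" "\<theta> \<le> 1" "real q * \<theta> = real l" using assms by (auto simp: \<theta>_def)
  have "real (q choose l) * \<theta> ^ l * exp (- real l) \<le> real (q choose l) * \<theta> ^ l * (1 - \<theta>) ^ (q - l)"
    using exp_le_one_minus_power[of \<theta> q l] assms th by (intro mult_left_mono) auto
  also have "\<dots> = mean {..<q} \<theta> (\<lambda>X. of_bool (card X = l))"
    using mean_card_eq[of "{..<q}" \<theta> l] th by simp
  also have "\<dots> \<le> mean {..<q} \<theta> (\<lambda>_. 1)"
    by (intro mean_mono) auto
  finally show ?thesis by (simp add: \<theta>_def exp_minus pos_divide_le_eq flip: divide_inverse)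
qed

text \<open>With \<open>Q = q ^ (n - 1)\<close> the number of lines is
  \<open>Q * (q * Q - 1) / (q - 1)\<close>. This lies between \<open>Q\<^sup>2\<close> and
  \<open>2 * Q\<^sup>2\<close>, the factor 2 coming from \<open>q \<le> 2 * (q - 1)\<close>.\<close>

lemma card_lines_bounds:
  assumes "linear_space V \<L> q" and card: "card V = q ^ n" and n: "1 \<le> n"
  shows "real q ^ (2 * n - 2) \<le> real (card \<L>)" "real (card \<L>) \<le> 2 * real q ^ (2 * n - 2)"
proof -
  interpret linear_space V \<L> q by fact
  define Q where "Q = real q ^ (n - 1)"
  have q: "2 \<le> real q" using q_ge_2 by simp
  have Q1: "1 \<le> Q" using q by (simp add: Q_def)
  have v: "real (card V) = real q * Q"
    using n by (cases n) (simp_all add: card Q_def)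
  have Q2: "real q ^ (2 * n - 2) = Q\<^sup>2"
  proof -
    have "2 * n - 2 = (n - 1) * 2" by simp
    thus ?thesis unfolding Q_def by (simp only: power_mult)
  qed
  have v1: "1 \<le> card V" using q_ge_2 by (simp add: card)
  have "real (card \<L>) * (real q * (real q - 1)) = real (card V) * (real (card V) - 1)"
    using card_lines_mult[THEN arg_cong[where f = real]] q_ge_2 v1 by (simp add: of_nat_diff)
  hence eq: "real (card \<L>) * (real q - 1) = Q * (real q * Q - 1)"
    using q by (simp add: v mult.left_commute)
  have "Q\<^sup>2 * (real q - 1) \<le> Q * (real q * Q - 1)"
    using Q1 by (simp add: power2_eq_square algebra_simps)
  also note eq[symmetric]
  finally show "real q ^ (2 * n - 2) \<le> real (card \<L>)"
    using q unfolding Q2 by simp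
  have "real (card \<L>) * (real q - 1) \<le> Q\<^sup>2 * real q"
    using Q1 unfolding eq by (simp add: power2_eq_square algebra_simps)
  also have "\<dots> \<le> Q\<^sup>2 * (2 * (real q - 1))" using q by (intro mult_left_mono) auto
  finally have "real (card \<L>) * (real q - 1) \<le> (2 * Q\<^sup>2) * (real q - 1)" by (simp add: algebra_simps)
  thus "real (card \<L>) \<le> 2 * real q ^ (2 * n - 2)"
    using q unfolding Q2 by simp
qed

definition rich_threshold :: "nat \<Rightarrow> nat \<Rightarrow> nat \<Rightarrow> real" where
  "rich_threshold n q l = (real q ^ (2 * n - 2) * real (q choose l)) powr (- 1 / real l)"

lemma rich_threshold_pos: "0 < q \<Longrightarrow> l \<le> q \<Longrightarrow> 0 < rich_threshold n q l"
  by (simp add: rich_threshold_def)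

text \<open>The estimates below use the threshold through this identity and positivity: up to a
  factor 2 in the number of lines, the expected number of pairs of a line and an
  \<open>l\<close>-subset of its random points is 1 at the threshold.\<close>

lemma rich_threshold_power:
  assumes "0 < q" "l \<le> q" "0 < l"
  shows "real q ^ (2 * n - 2) * real (q choose l) * rich_threshold n q l ^ l = 1"
proof -
  have pos: "0 < real q ^ (2 * n - 2) * real (q choose l)" using assms by simp
  have "rich_threshold n q l ^ l = rich_threshold n q l powr real l"
    using rich_threshold_pos[of q l n] assms by (simp add: powr_realpow)
  also have "\<dots> = inverse (real q ^ (2 * n - 2) * real (q choose l))"
    using pos assms unfolding rich_threshold_def powr_powr by (simp add: powr_minus)
  finally show ?thesis using pos by (metis less_irrefl right_inverse)
qed

text \<open>Turns the variance term \<open>l\<^sup>2 / (q\<^sup>n \<theta>)\<close> into a multiple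
  of \<open>t / \<theta>\<close>. The inequality is proved for \<open>l\<close>-th powers multiplied
  by \<open>Q\<close>, where \<open>Q * t ^ l = 1\<close> removes the root.\<close>

lemma rich_threshold_lower:
  assumes "2 \<le> l" "l \<le> q" "2 \<le> n"
  shows "(real l)\<^sup>2 \<le> 4 * exp 1 * (real q ^ n * rich_threshold n q l)"
proof -
  define t where "t = rich_threshold n q l"
  define Q where "Q = real q ^ (2 * n - 2) * real (q choose l)"
  have q0: "0 < q" using assms by simp
  have t0: "0 < t" using rich_threshold_pos assms by (simp add: t_def)
  have Q0: "0 < Q" using assms by (simp add: Q_def)
  have Qt: "Q * t ^ l = 1"
    using rich_threshold_power[of q l n] assms by (simp add: t_def Q_def)
  \<comment> \<open>Half of the factors \<open>l\<close> are written as \<open>q * (l / q)\<close>,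
    so that \<open>choose_le_exp\<close> absorbs the binomial coefficient.\<close>
  have "((real l)\<^sup>2) ^ l * Q = (real l)^l * real q ^ l * real q ^ (2 * n - 2) * (real (q choose l) * (real l / real q) ^ l)"
    using q0 by (simp add: Q_def power_divide power2_eq_square power_mult_distrib)
  also have "\<dots> \<le> (real l)^l * real q ^ l * real q ^ (2 * n - 2) * exp (real l)"
    using choose_le_exp[of l q] assms by (intro mult_left_mono) auto
  \<comment> \<open>Two of the factors are bounded by \<open>2 ^ l\<close> instead of
    \<open>q\<close>; the two powers of \<open>q\<close> saved are what makes the exponent fit
    below.\<close>
  also have "(real l)^l \<le> 4 ^ l * real q ^ (l - 2)"
  proof -
    have "(real l)^l = (real l)\<^sup>2 * real l ^ (l - 2)"
      using power_add[of "real l" 2 "l - 2"] assms by (simp only: le_add_diff_inverse)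
    also have "\<dots> \<le> (2 ^ l)\<^sup>2 * real q ^ (l - 2)"
      using assms by (intro mult_mono power_mono) (auto simp: less_imp_le)
    finally show ?thesis by (simp add: power_mult[symmetric] mult.commute[of l] power_mult)
  qed
  also have "4 ^ l * real q ^ (l - 2) * real q ^ l * real q ^ (2 * n - 2) * exp (real l)
      = (4 * exp 1) ^ l * real q ^ ((l - 2) + l + (2 * n - 2))"
    by (simp add: power_add power_mult_distrib exp_of_nat_mult[symmetric])
  also have "real q ^ ((l - 2) + l + (2 * n - 2)) \<le> real q ^ (n * l)"
  proof (rule power_increasing)
    \<comment> \<open>The difference of the two exponents is
      \<open>(l - 2) * (n - 2) = a * b\<close>.\<close>
    obtain a b where "l = a + 2" "n = b + 2" using assms by (metis add.commute le_Suc_ex)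
    thus "(l - 2) + l + (2 * n - 2) \<le> n * l" by (simp add: algebra_simps)
  qed (use q0 in simp)
  finally have "((real l)\<^sup>2) ^ l * Q \<le> (4 * exp 1) ^ l * real q ^ (n * l)"
    by (simp add: mult_right_mono mult_left_mono)
  also have "\<dots> = (4 * exp 1 * (real q ^ n * t)) ^ l * Q"
  proof -
    have "(4 * exp 1 * (real q ^ n * t)) ^ l * Q
        = (4 * exp 1) ^ l * real q ^ (n * l) * (Q * t ^ l)"
      unfolding power_mult by (simp add: power_mult_distrib mult_ac)
    thus ?thesis by (simp add: Qt)
  qed
  finally have "((real l)\<^sup>2) ^ l \<le> (4 * exp 1 * (real q ^ n * t)) ^ l" using Q0 by simp
  thus ?thesis
    using assms t0 unfolding t_def[symmetric] by (subst (asm) power_mono_iff) auto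
qed

section \<open>Explicit bounds on both sides of the threshold\<close>

lemma prob_rich_line_eq:
  "prob_rich_line F n l \<theta> = measure_pmf.prob (random_subset (carrier (affine_space F n)) \<theta>)
    {X. \<exists>L\<in>Collect (is_line F n). rich l X L}"
  by (simp add: prob_rich_line_def)

lemma prob_rich_line_le:
  assumes F: "field F" "finite (carrier F)" "card (carrier F) = q"
    and n: "1 \<le> n" and l: "1 \<le> l" "l \<le> q" and th: "0 \<le> \<theta>" "\<theta> \<le> 1"
  shows "prob_rich_line F n l \<theta> \<le> 2 * (\<theta> / rich_threshold n q l) ^ l"
proof -
  interpret linear_space "carrier (affine_space F n)" "Collect (is_line F n)" q
    using field.linear_space_lines F by blast
  define t where "t = rich_threshold n q l"
  have t0: "0 < t" using rich_threshold_pos l by (simp add: t_def)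
  have Qt: "real q ^ (2 * n - 2) * real (q choose l) = 1 / t ^ l"
    using rich_threshold_power[of q l n] l t0 by (simp add: t_def field_simps)
  have "prob_rich_line F n l \<theta> \<le> real (card (Collect (is_line F n))) * (real (q choose l) * \<theta> ^ l)"
    unfolding prob_rich_line_eq by (intro prob_rich_le th)
  also have "\<dots> \<le> 2 * real q ^ (2 * n - 2) * (real (q choose l) * \<theta> ^ l)"
    using card_lines_bounds(2)[OF linear_space_axioms _ n] field.card_affine_space[OF F(1)] F(3) th
    by (intro mult_right_mono) auto
  also have "\<dots> = 2 * (real q ^ (2 * n - 2) * real (q choose l)) * \<theta> ^ l" by simp
  also have "\<dots> = 2 * (\<theta> / t) ^ l"
    unfolding Qt by (simp add: power_divide)
  finally show ?thesis by (simp add: t_def)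
qed

text \<open>Both terms of \<open>prob_no_rich_le\<close> are made explicit. The coefficient 5 is 1
  from the expected number of rich lines plus 4 from \<open>rich_threshold_lower\<close>.\<close>

lemma prob_rich_line_ge:
  assumes F: "field F" "finite (carrier F)" "card (carrier F) = q"
    and n: "2 \<le> n" and l: "2 \<le> l" "l \<le> q" and th: "\<theta> \<le> 1"
    and big: "exp 1 * rich_threshold n q l \<le> \<theta>"
  shows "1 - prob_rich_line F n l \<theta> \<le> 2 / real (n + q) + 5 * exp 1 * (rich_threshold n q l / \<theta>)"
proof -
  let ?V = "carrier (affine_space F n)" and ?\<L> = "Collect (is_line F n)"
  interpret linear_space ?V ?\<L> q
    using field.linear_space_lines F by blast
  define t where "t = rich_threshold n q l"
  define b where "b = real (card ?\<L>)"
  have q: "2 \<le> real q" using q_ge_2 by simp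
  have t0: "0 < t" using rich_threshold_pos l by (simp add: t_def)
  have th0: "0 < \<theta>" using big t0 unfolding t_def[symmetric]
    by (smt (verit) exp_gt_zero mult_pos_pos)
  have card: "card ?V = q ^ n" using field.card_affine_space[OF F(1)] F(3) by simp
  have b: "real q ^ (2 * n - 2) \<le> b"
    using card_lines_bounds(1)[OF linear_space_axioms card] n by (simp add: b_def)
  hence b0: "0 < b" using q by (smt (verit) zero_less_power)
  hence ne: "?\<L> \<noteq> {}" unfolding b_def by (metis card.empty of_nat_0 order_less_irrefl)
  then obtain L0 where L0: "L0 \<in> ?\<L>" by blast
  define p where "p = mean L0 \<theta> (\<lambda>X. of_bool (l \<le> card X))"
  have p: "mean L \<theta> (\<lambda>X. of_bool (l \<le> card X)) = p" if "L \<in> ?\<L>" for L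
    unfolding p_def using mean_card_cong[of L L0 \<theta> "\<lambda>k. of_bool (l \<le> k)"] that L0 th th0
    by (simp add: card_line finite_line)
  \<comment> \<open>The minimum covers two regimes, according to whether a line expects at least
    \<open>l\<close> random points.\<close>
  have bp: "min (real (n + q) / 2) (\<theta> / (exp 1 * t)) \<le> b * p"
  proof (cases "real l \<le> real q * \<theta>")
    case True
    have "1 \<le> real q * p"
      unfolding p_def using mean_card_ge_inverse[of L0 \<theta> l] True th th0 l L0
      by (simp add: card_line finite_line)
    hence p: "1 / real q \<le> p" using q by (simp add: field_simps)
    \<comment> \<open>In the dense regime \<open>p \<ge> 1 / q\<close>, so the number of lines alone
      must make \<open>b * p\<close> large: both \<open>n\<close> and \<open>q\<close> are at most
      \<open>q ^ (n - 1)\<close>.\<close>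
    have "n + q \<le> 2 * q ^ (n - 1)"
    proof -
      have "n \<le> 2 ^ (n - 1)" using n less_exp[of "n - 1"] by linarith
      also have "\<dots> \<le> q ^ (n - 1)" using q_ge_2 by (intro power_mono) auto
      finally have "n \<le> q ^ (n - 1)" .
      moreover have "q ^ 1 \<le> q ^ (n - 1)" using q_ge_2 n by (intro power_increasing) auto
      ultimately show ?thesis by simp
    qed
    hence "real (n + q) \<le> 2 * real q ^ (n - 1)" by (metis of_nat_le_iff of_nat_mult of_nat_numeral of_nat_power)
    also have "\<dots> \<le> 2 * real q ^ (2 * n - 3)"
      using q n by (intro mult_left_mono power_increasing) auto
    also have "real q ^ (2 * n - 3) = real q ^ (2 * n - 2) * (1 / real q)"
    proof -
      have "2 * n - 2 = Suc (2 * n - 3)" using n by simp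
      thus ?thesis using q by simp
    qed
    also have "\<dots> \<le> b * p" using b p q b0 by (intro mult_mono) auto
    finally have "real (n + q) / 2 \<le> b * p" by simp
    thus ?thesis by (rule min.coboundedI1)
  next
    case False
    \<comment> \<open>In the sparse regime the ratio is at least 1, so its \<open>l\<close>-th power
      dominates it. The factor \<open>exp 1\<close> in the ratio pays for the loss
      \<open>exp (- l)\<close> in bounding \<open>(1 - \<theta>) ^ (q - l)\<close>.\<close>
    have big': "1 \<le> \<theta> / (exp 1 * t)" using big t0 by (simp add: t_def field_simps)
    have "\<theta> / (exp 1 * t) \<le> (\<theta> / (exp 1 * t)) ^ l"
      using power_increasing[of 1 l, OF _ big'] l by simp
    also have "\<dots> = real q ^ (2 * n - 2) * real (q choose l) * t ^ l * (\<theta> / (exp 1 * t)) ^ l"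
      using rich_threshold_power[of q l n] l by (simp add: t_def)
    also have "\<dots> = real q ^ (2 * n - 2) * (real (q choose l) * \<theta> ^ l * exp (- real l))"
      using t0 by (simp add: power_divide power_mult_distrib exp_minus exp_of_nat_mult[symmetric] field_simps)
    also have "\<dots> \<le> b * p"
    proof (intro mult_mono b)
      have "real (q choose l) * \<theta> ^ l * exp (- real l) \<le> real (q choose l) * \<theta> ^ l * (1 - \<theta>) ^ (q - l)"
        using exp_le_one_minus_power[of \<theta> q l] False th0 l by (intro mult_left_mono) auto
      also have "\<dots> \<le> p"
        unfolding p_def using mean_card_ge_lower[of L0 \<theta> l] th th0 L0 by (simp add: card_line finite_line)
      finally show "real (q choose l) * \<theta> ^ l * exp (- real l) \<le> p" .
    qed (use b0 th0 in auto)
    finally show ?thesis by (rule min.coboundedI2)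
  qed
  have nq: "0 < real (n + q) / 2" and tt: "0 < \<theta> / (exp 1 * t)" using n th0 t0 by auto
  with bp have bp0: "0 < b * p" by linarith
  hence p0: "0 < p" using b0 by (simp add: zero_less_mult_iff)
  have "1 - prob_rich_line F n l \<theta> \<le> 1 / (b * p) + (real l)\<^sup>2 / (real (card ?V) * \<theta>)"
    unfolding prob_rich_line_eq b_def by (intro prob_no_rich_le th0 th p p0 ne) (use l in auto)
  also have "1 / (b * p) \<le> 2 / real (n + q) + exp 1 * (t / \<theta>)"
  proof -
    have "1 / (b * p) \<le> 1 / min (real (n + q) / 2) (\<theta> / (exp 1 * t))"
      using bp nq tt by (intro divide_left_mono) (auto simp: bp0)
    \<comment> \<open>The reciprocal of a minimum of positive numbers is one of the two reciprocals,
      hence at most their sum.\<close>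
    also have "\<dots> \<le> 1 / (real (n + q) / 2) + 1 / (\<theta> / (exp 1 * t))"
      using nq tt unfolding min_def by (smt (verit) zero_less_divide_1_iff)
    finally show ?thesis by (simp add: mult.commute)
  qed
  also have "(real l)\<^sup>2 / (real (card ?V) * \<theta>) \<le> 4 * exp 1 * (t / \<theta>)"
  proof -
    have "(real l)\<^sup>2 / (real q ^ n * \<theta>) \<le> 4 * exp 1 * (real q ^ n * t) / (real q ^ n * \<theta>)"
      using rich_threshold_lower[of l q n] l n th0 q unfolding t_def by (intro divide_right_mono) auto
    also have "\<dots> = 4 * exp 1 * (t / \<theta>)" using q by simp
    finally show ?thesis by (simp add: card)
  qed
  finally show ?thesis by (simp add: t_def algebra_simps)
qed

theorem theorem1p4:
  fixes F :: "nat \<Rightarrow> ('a, 'm) ring_scheme"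
    and n q l :: "nat \<Rightarrow> nat"
  assumes "\<And>k. n k \<ge> 2"
    and "\<And>k. primepow (q k)"
    and "\<And>k. field (F k)"
    and "\<And>k. finite (carrier (F k))"
    and "\<And>k. card (carrier (F k)) = q k"
    and "filterlim (\<lambda>k. n k + q k) at_top sequentially"
    and "\<And>k. 3 \<le> l k"
    and "\<And>k. l k \<le> q k"
    and "(\<lambda>k. real (l k)) \<in> O(\<lambda>k. real (n k) * ln (real (q k)))"
  shows "threshold_function
           (\<lambda>k \<theta>. prob_rich_line (F k) (n k) (l k) \<theta>)
           (\<lambda>k. (real (q k) ^ (2 * n k - 2) * real (q k choose l k)) powr (- 1 / real (l k)))"
proof -
  note l = assms(7,8)
  define t where "t k = rich_threshold (n k) (q k) (l k)" for k
  have t0: "0 < t k" for k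
    using rich_threshold_pos[of "q k" "l k"] l[of k] by (simp add: t_def)
  have prob_le_1: "prob_rich_line (F k) (n k) (l k) x \<le> 1" for k x
    by (simp add: prob_rich_line_def)
  have "threshold_function (\<lambda>k \<theta>. prob_rich_line (F k) (n k) (l k) \<theta>) t"
    unfolding threshold_function_def
  proof (intro allI impI conjI)
    fix \<theta> :: "nat \<Rightarrow> real" assume th: "\<forall>k. 0 \<le> \<theta> k \<and> \<theta> k \<le> 1"
    assume "\<theta> \<in> o(t)"
    hence lim: "(\<lambda>k. \<theta> k / t k) \<longlonglongrightarrow> 0" by (rule smalloD_tendsto)
    show "(\<lambda>k. prob_rich_line (F k) (n k) (l k) (\<theta> k)) \<longlonglongrightarrow> 0"
    proof (rule tendsto_sandwich[where f = "\<lambda>_. 0"])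
      show "(\<lambda>k. 2 * (\<theta> k / t k)) \<longlonglongrightarrow> 0" using tendsto_mult_left[OF lim, of 2] by simp
      have "eventually (\<lambda>k. \<theta> k / t k < 1) sequentially" by (rule order_tendstoD(2)[OF lim]) simp
      thus "eventually (\<lambda>k. prob_rich_line (F k) (n k) (l k) (\<theta> k) \<le> 2 * (\<theta> k / t k)) sequentially"
      proof eventually_elim
        case (elim k)
        have "prob_rich_line (F k) (n k) (l k) (\<theta> k) \<le> 2 * (\<theta> k / t k) ^ l k"
          unfolding t_def using assms(1)[of k] l[of k] th assms(3-5)
          by (intro prob_rich_line_le) auto
        \<comment> \<open>Once the ratio is below 1, its first power bounds every
          \<open>l k\<close>-th power, however \<open>l k\<close> varies with
          \<open>k\<close>.\<close>
        also have "(\<theta> k / t k) ^ l k \<le> (\<theta> k / t k) ^ 1"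
          using elim th t0[of k] l(1)[of k] by (intro power_decreasing) auto
        finally show ?case by simp
      qed
    qed (auto simp: prob_rich_line_def)
  next
    fix \<theta> :: "nat \<Rightarrow> real" assume th: "\<forall>k. 0 \<le> \<theta> k \<and> \<theta> k \<le> 1"
    assume om: "\<theta> \<in> \<omega>(t)"
    hence lim: "(\<lambda>k. t k / \<theta> k) \<longlonglongrightarrow> 0" by (simp add: smallomega_iff_smallo smalloD_tendsto)
    \<comment> \<open>The constant \<open>exp 1\<close> is the one demanded by
      \<open>prob_rich_line_ge\<close>.\<close>
    have "eventually (\<lambda>k. norm (\<theta> k) \<ge> exp 1 * norm (t k)) sequentially"
      using om by (rule landau_omega.smallD) simp
    hence ev: "eventually (\<lambda>k. exp 1 * t k \<le> \<theta> k) sequentially"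
      using th t0 by (simp add: less_imp_le)
    have lim_nq: "(\<lambda>k. 2 / real (n k + q k)) \<longlonglongrightarrow> 0"
      by (rule real_tendsto_divide_at_top[OF tendsto_const])
         (rule filterlim_compose[OF filterlim_real_sequentially assms(6)])
    show "(\<lambda>k. prob_rich_line (F k) (n k) (l k) (\<theta> k)) \<longlonglongrightarrow> 1"
    proof (rule tendsto_sandwich)
      show "(\<lambda>k. 1 - (2 / real (n k + q k) + 5 * exp 1 * (t k / \<theta> k))) \<longlonglongrightarrow> 1"
        using tendsto_diff[OF tendsto_const[of 1]
            tendsto_add[OF lim_nq tendsto_mult_left[OF lim, of "5 * exp 1"]]] by simp
      show "eventually (\<lambda>k. 1 - (2 / real (n k + q k) + 5 * exp 1 * (t k / \<theta> k))
          \<le> prob_rich_line (F k) (n k) (l k) (\<theta> k)) sequentially"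
        using ev
      proof eventually_elim
        case (elim k)
        have "2 \<le> l k" using l(1)[of k] by simp
        from prob_rich_line_ge[OF assms(3-5) assms(1)[of k] this l(2), of "\<theta> k"] elim th
        show ?case by (simp add: t_def)
      qed
    qed (use prob_le_1 in auto)
  qed
  thus ?thesis by (simp add: t_def[abs_def] rich_threshold_def)
qed

end
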